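(* The groups \[ \Gamma_{5} = \langle a,b,c,d \mid acac^{-1}, \, adad^{-1}, \, bcb^{-1}c, \, bdb^{-1}d \rangle \] and \[ \Gamma_{10} = \langle a,b,c,d \mid acac^{-1}, \, ada^{-1}d, \, bcbc^{-1}, \, bdb^{-1}d^{-1} \rangle \] are isomorphic.
   Context: The groups are given by finite presentations (generators, and relators set equal to $1$). *)

theory Defs
  imports "HOL-Algebra.Coset"
begin

datatype 'g letter = Pos 'g | Neg 'g  \<comment> \<open>a generator, respectively its formal inverse\<close>

type_synonym 'g word = "'g letter list"

fun flip :: "'g letter \<Rightarrow> 'g letter" where
  "flip (Pos x) = Neg x"
| "flip (Neg x) = Pos x"

inductive cancels :: "'g word \<Rightarrow> 'g word \<Rightarrow> bool" where
  "cancels (u @ [l, flip l] @ v) (u @ v)"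

definition free_rel :: "('g word \<times> 'g word) set" where
  "free_rel = {(u, v). equivclp cancels u v}"

definition word_class :: "'g word \<Rightarrow> 'g word set" where
  "word_class w = free_rel `` {w}"

text \<open>The free group on all elements of the type of generators. The union in the product
  is that of a single class, since concatenation respects \<^const>\<open>free_rel\<close>.\<close>

definition free_group :: "'g word set monoid" where
  "free_group = \<lparr>carrier = UNIV // free_rel,
                 mult = (\<lambda>X Y. \<Union>u\<in>X. \<Union>v\<in>Y. word_class (u @ v)),
                 one = word_class []\<rparr>"

definition normal_closure :: "('a, 'b) monoid_scheme \<Rightarrow> 'a set \<Rightarrow> 'a set" where
  "normal_closure G R = \<Inter>{N. N \<lhd> G \<and> R \<subseteq> N}"

definition presented_group :: "'g word set \<Rightarrow> 'g word set set monoid" where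
  "presented_group R = free_group Mod normal_closure free_group (word_class ` R)"

lemma flip_flip [simp]: "flip (flip l) = l"
  by (cases l) auto

lemma equiv_free_rel: "equiv UNIV free_rel"
  unfolding free_rel_def
  by (rule equivI) (auto intro!: refl_onI symI transI intro: equivclp_sym equivclp_trans)

lemma word_class_eq_iff: "word_class u = word_class v \<longleftrightarrow> (u, v) \<in> free_rel"
  unfolding word_class_def using eq_equiv_class_iff[OF equiv_free_rel] by auto

lemma free_rel_append_context:
  assumes "(u, v) \<in> free_rel"
  shows "(p @ u @ q, p @ v @ q) \<in> free_rel"
proof -
  have step: "cancels (p @ x @ q) (p @ y @ q)" if "cancels x y" for x y
    using that
  proof cases
    case (1 s l t)
    then show ?thesis
      using cancels.intros[of "p @ s" l "t @ q"] by simp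
  qed
  have "equivclp cancels u v"
    using assms by (simp add: free_rel_def)
  then have "equivclp cancels (p @ u @ q) (p @ v @ q)"
  proof (induction rule: equivclp_induct)
    case base
    then show ?case by simp
  next
    case (step y z)
    then have "equivclp cancels (p @ y @ q) (p @ z @ q)"
      using \<open>\<And>x y. cancels x y \<Longrightarrow> cancels (p @ x @ q) (p @ y @ q)\<close>
      by (meson equivclp_sym r_into_equivclp)
    with step.IH show ?case by (rule equivclp_trans)
  qed
  then show ?thesis by (simp add: free_rel_def)
qed

lemma free_rel_append:
  assumes "(u, u') \<in> free_rel" "(v, v') \<in> free_rel"
  shows "(u @ v, u' @ v') \<in> free_rel"
  using free_rel_append_context[OF assms(1), of "[]" v]
    free_rel_append_context[OF assms(2), of u' "[]"]
    equiv_free_rel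
  by (auto elim!: equivE dest: transD)

lemma mult_word_class [simp]:
  "word_class u \<otimes>\<^bsub>free_group\<^esub> word_class v = word_class (u @ v)"
proof -
  have "word_class (u' @ v') = word_class (u @ v)"
    if "u' \<in> word_class u" "v' \<in> word_class v" for u' v'
    using that free_rel_append[of u u' v v']
    by (metis Image_singleton_iff word_class_def word_class_eq_iff)
  moreover have "u \<in> word_class u" "v \<in> word_class v"
    using equiv_free_rel by (auto simp: word_class_def elim!: equivE dest: refl_onD)
  ultimately have "(\<Union>u'\<in>word_class u. \<Union>v'\<in>word_class v. word_class (u' @ v')) = word_class (u @ v)"
    by blast
  then show ?thesis
    by (simp add: free_group_def)
qed

lemma one_free_group: "\<one>\<^bsub>free_group\<^esub> = word_class []"
  by (simp add: free_group_def)

lemma carrier_free_group: "carrier free_group = range word_class"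
  by (auto simp: free_group_def quotient_def word_class_def)

lemma word_class_inverse: "word_class (rev (map flip w) @ w) = word_class []"
proof (induction w)
  case Nil
  then show ?case by simp
next
  case (Cons l w)
  have "cancels (rev (map flip w) @ [flip l, flip (flip l)] @ w) (rev (map flip w) @ w)"
    by (rule cancels.intros)
  then have "word_class (rev (map flip (l # w)) @ l # w) = word_class (rev (map flip w) @ w)"
    by (auto simp: word_class_eq_iff free_rel_def)
  then show ?case using Cons.IH by simp
qed

lemma group_free_group: "group (free_group :: 'g word set monoid)"
proof (rule groupI)
  fix x :: "'g word set"
  assume "x \<in> carrier free_group"
  then obtain w where "x = word_class w"
    by (auto simp: carrier_free_group)
  then have "word_class (rev (map flip w)) \<otimes>\<^bsub>free_group\<^esub> x = \<one>\<^bsub>free_group\<^esub>"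
    by (simp add: word_class_inverse one_free_group)
  then show "\<exists>y\<in>carrier free_group. y \<otimes>\<^bsub>free_group\<^esub> x = \<one>\<^bsub>free_group\<^esub>"
    by (auto simp: carrier_free_group)
qed (auto simp: carrier_free_group one_free_group)

lemma (in group) normal_closure_normal:
  assumes "R \<subseteq> carrier G"
  shows "normal_closure G R \<lhd> G"
proof -
  have ne: "carrier G \<in> {N. N \<lhd> G \<and> R \<subseteq> N}"
    using assms by (simp add: normal_invI subgroup_self)
  have "subgroup (normal_closure G R) G"
    unfolding normal_closure_def
    by (rule subgroups_Inter) (use ne normal_imp_subgroup in auto)
  then show ?thesis
    by (rule normal_invI) (auto simp: normal_closure_def intro: normal.inv_op_closed2)
qed

lemma group_presented_group: "group (presented_group R)"
  unfolding presented_group_def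
  by (intro normal.factorgroup_is_group group.normal_closure_normal group_free_group)
     (auto simp: carrier_free_group)

datatype gen = a | b | c | d

definition Gamma5 :: "gen word set set monoid" where
  "Gamma5 = presented_group
     {[Pos a, Pos c, Pos a, Neg c],
      [Pos a, Pos d, Pos a, Neg d],
      [Pos b, Pos c, Neg b, Pos c],
      [Pos b, Pos d, Neg b, Pos d]}"

definition Gamma10 :: "gen word set set monoid" where
  "Gamma10 = presented_group
     {[Pos a, Pos c, Pos a, Neg c],
      [Pos a, Pos d, Neg a, Pos d],
      [Pos b, Pos c, Pos b, Neg c],
      [Pos b, Pos d, Neg b, Neg d]}"

end

theory Submission imports Defs begin

text \<open>The relators of \<open>\<Gamma>\<^sub>5\<close> say that \<open>c\<close> and \<open>d\<close> invert \<open>a\<close> and that \<open>b\<close> inverts \<open>c\<close> and \<open>d\<close>;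
  those of \<open>\<Gamma>\<^sub>1\<^sub>0\<close> say that \<open>c\<close> inverts \<open>a\<close> and \<open>b\<close>, that \<open>a\<close> inverts \<open>d\<close> and that \<open>b\<close> commutes
  with \<open>d\<close>. In \<open>\<Gamma>\<^sub>1\<^sub>0\<close> both \<open>a\<close> and \<open>ab\<close> therefore invert \<open>d\<close>, and \<open>ac\<close> inverts both \<open>a\<close> and
  \<open>ab\<close>. Hence \<open>a \<mapsto> d\<close>, \<open>b \<mapsto> ac\<close>, \<open>c \<mapsto> a\<close>, \<open>d \<mapsto> ab\<close> defines a homomorphism \<open>\<Gamma>\<^sub>5 \<rightarrow> \<Gamma>\<^sub>1\<^sub>0\<close>,
  with inverse \<open>a \<mapsto> c\<close>, \<open>b \<mapsto> c\<inverse>d\<close>, \<open>c \<mapsto> c\<inverse>b\<close>, \<open>d \<mapsto> a\<close>.\<close>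

section \<open>Evaluation of words in a group\<close>

primrec letter_value :: "('a, 'b) monoid_scheme \<Rightarrow> ('g \<Rightarrow> 'a) \<Rightarrow> 'g letter \<Rightarrow> 'a" where
  "letter_value G f (Pos x) = f x"
| "letter_value G f (Neg x) = inv\<^bsub>G\<^esub> f x"

primrec word_value :: "('a, 'b) monoid_scheme \<Rightarrow> ('g \<Rightarrow> 'a) \<Rightarrow> 'g word \<Rightarrow> 'a" where
  "word_value G f [] = \<one>\<^bsub>G\<^esub>"
| "word_value G f (l # w) = letter_value G f l \<otimes>\<^bsub>G\<^esub> word_value G f w"

context group
begin

lemma letter_value_closed [simp]:
  assumes "range f \<subseteq> carrier G"
  shows "letter_value G f l \<in> carrier G"
  using assms by (cases l) auto

lemma word_value_closed [simp]:
  assumes "range f \<subseteq> carrier G"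
  shows "word_value G f w \<in> carrier G"
  using assms by (induction w) auto

lemma word_value_append:
  assumes "range f \<subseteq> carrier G"
  shows "word_value G f (u @ v) = word_value G f u \<otimes> word_value G f v"
  using assms by (induction u) (auto simp: m_assoc)

lemma letter_value_flip:
  assumes "range f \<subseteq> carrier G"
  shows "letter_value G f l \<otimes> letter_value G f (flip l) = \<one>"
  using assms by (cases l) (auto simp: image_subset_iff)

lemma word_value_cancels:
  assumes f: "range f \<subseteq> carrier G" and "cancels u v"
  shows "word_value G f u = word_value G f v"
  using assms(2)
proof cases
  case (1 s l t)
  have "letter_value G f l \<otimes> (letter_value G f (flip l) \<otimes> word_value G f t) = word_value G f t"
    using f by (simp add: letter_value_flip flip: m_assoc)
  then show ?thesis
    using f 1 by (simp add: word_value_append)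
qed

lemma word_value_free_rel:
  assumes f: "range f \<subseteq> carrier G" and "(u, v) \<in> free_rel"
  shows "word_value G f u = word_value G f v"
proof -
  have "equivclp cancels u v"
    using assms(2) by (simp add: free_rel_def)
  then show ?thesis
    by (induction rule: equivclp_induct) (auto dest: word_value_cancels[OF f])
qed

end

section \<open>Cosets of words, the universal property of a presentation, and an isomorphism
  criterion\<close>

definition presented_class :: "'g word set \<Rightarrow> 'g word \<Rightarrow> 'g word set set" where
  "presented_class R w = normal_closure free_group (word_class ` R) #>\<^bsub>free_group\<^esub> word_class w"

lemma normal_closure_relators: "normal_closure free_group (word_class ` R) \<lhd> free_group"
  by (intro group.normal_closure_normal group_free_group) (auto simp: carrier_free_group)

lemma carrier_presented_group: "carrier (presented_group R) = range (presented_class R)"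
  unfolding presented_group_def presented_class_def FactGroup_def RCOSETS_def
  by (auto simp: carrier_free_group)

lemma presented_class_in_carrier [simp]: "presented_class R w \<in> carrier (presented_group R)"
  by (simp add: carrier_presented_group)

lemma mult_presented_class [simp]:
  "presented_class R u \<otimes>\<^bsub>presented_group R\<^esub> presented_class R v = presented_class R (u @ v)"
  unfolding presented_class_def presented_group_def FactGroup_def
  by (simp add: normal.rcos_sum[OF normal_closure_relators] carrier_free_group)

lemma one_presented_group: "\<one>\<^bsub>presented_group R\<^esub> = presented_class R []"
proof -
  interpret free: group "free_group :: 'a word set monoid"
    by (rule group_free_group)
  show ?thesis
    using normal_imp_subgroup[OF normal_closure_relators, of R, THEN subgroup.subset]
    by (simp add: presented_class_def presented_group_def FactGroup_def free.coset_mult_one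
        flip: one_free_group)
qed

lemma presented_class_free_rel:
  "(u, v) \<in> free_rel \<Longrightarrow> presented_class R u = presented_class R v"
  by (simp add: presented_class_def flip: word_class_eq_iff)

lemma presented_class_relator:
  assumes "r \<in> R"
  shows "presented_class R r = \<one>\<^bsub>presented_group R\<^esub>"
proof -
  interpret free: group "free_group :: 'a word set monoid"
    by (rule group_free_group)
  have "word_class r \<in> normal_closure free_group (word_class ` R)"
    using assms by (auto simp: normal_closure_def)
  then show ?thesis
    unfolding presented_class_def presented_group_def FactGroup_def
    using free.coset_join2[OF _ normal_imp_subgroup[OF normal_closure_relators]]
    by (simp add: carrier_free_group)
qed

lemma presented_class_Neg:
  "presented_class R [Neg x] = inv\<^bsub>presented_group R\<^esub> presented_class R [Pos x]"
proof (rule group.inv_equality[OF group_presented_group, symmetric])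
  have "cancels ([] @ [Neg x, flip (Neg x)] @ []) ([] @ [])"
    by (rule cancels.intros)
  then show "presented_class R [Neg x] \<otimes>\<^bsub>presented_group R\<^esub> presented_class R [Pos x]
      = \<one>\<^bsub>presented_group R\<^esub>"
    by (auto simp: one_presented_group free_rel_def intro!: presented_class_free_rel)
qed auto

text \<open>Evaluation at the generators is the quotient map. This turns classes of words, in
  particular of relators, into products of generators.\<close>

lemma word_value_presented_class:
  "word_value (presented_group R) (\<lambda>x. presented_class R [Pos x]) w = presented_class R w"
proof (induction w)
  case (Cons l w)
  have "letter_value (presented_group R) (\<lambda>x. presented_class R [Pos x]) l = presented_class R [l]"
    by (cases l) (simp_all add: presented_class_Neg)
  with Cons show ?case by simp
qed (simp add: one_presented_group)

text \<open>Von Dyck's theorem: evaluation descends to the free group, and its kernel is a normal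
  subgroup containing the relators, hence their normal closure.\<close>

lemma (in group) presented_group_hom:
  assumes f: "range f \<subseteq> carrier G"
    and R: "\<And>r. r \<in> R \<Longrightarrow> word_value G f r = \<one>"
  obtains h where "h \<in> hom (presented_group R) G"
    and "\<And>w. h (presented_class R w) = word_value G f w"
proof -
  \<comment> \<open>The chosen representative does not matter, because equivalent words have equal
    values.\<close>
  define g where "g X = word_value G f (SOME w. X = word_class w)" for X
  have g: "g (word_class w) = word_value G f w" for w
  proof -
    have "word_class w = word_class (SOME w'. word_class w = word_class w')"
      by (rule someI) simp
    then show ?thesis
      unfolding g_def using word_value_free_rel[OF f] by (metis word_class_eq_iff)
  qed
  have "g \<in> hom free_group G"
    by (rule homI) (auto simp: carrier_free_group g f word_value_append)
  then interpret g: group_hom free_group G g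
    by (simp add: group_hom_def group_hom_axioms_def group_free_group)
  have "normal_closure free_group (word_class ` R) \<subseteq> kernel free_group G g"
    unfolding normal_closure_def
    by (rule Inter_lower)
       (use g.normal_kernel R in \<open>auto simp: kernel_def g carrier_free_group\<close>)
  then obtain h where "h \<in> hom (presented_group R) G"
      and "\<And>X. X \<in> carrier free_group \<Longrightarrow>
        h (normal_closure free_group (word_class ` R) #>\<^bsub>free_group\<^esub> X) = g X"
    using g.FactGroup_universal_kernel[OF normal_closure_relators]
    unfolding presented_group_def by metis
  then show thesis
    by (intro that) (auto simp: presented_class_def carrier_free_group g)
qed

lemma hom_word_value:
  assumes "group G" "group H" "h \<in> hom G H" "range f \<subseteq> carrier G"
  shows "h (word_value G f w) = word_value H (\<lambda>x. h (f x)) w"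
proof -
  interpret group_hom G H h
    using assms by (simp add: group_hom_def group_hom_axioms_def)
  have "h (letter_value G f l) = letter_value H (\<lambda>x. h (f x)) l" for l
    using assms(4) by (cases l) (auto simp: image_subset_iff)
  then show ?thesis
    using assms(4) by (induction w) (auto simp: G.letter_value_closed G.word_value_closed)
qed

text \<open>Both assignments extend to homomorphisms by \<open>presented_group_hom\<close>. Their
  composites fix the generators, hence every class, so they are mutually inverse.\<close>

lemma presented_group_isoI:
  fixes p :: "'g \<Rightarrow> 'h word" and q :: "'h \<Rightarrow> 'g word"
    and R :: "'g word set" and S :: "'h word set"
  defines "f \<equiv> \<lambda>x. presented_class S (p x)" and "k \<equiv> \<lambda>y. presented_class R (q y)"
  assumes f: "\<And>r. r \<in> R \<Longrightarrow> word_value (presented_group S) f r = \<one>\<^bsub>presented_group S\<^esub>"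
    and k: "\<And>s. s \<in> S \<Longrightarrow> word_value (presented_group R) k s = \<one>\<^bsub>presented_group R\<^esub>"
    and kf: "\<And>x. word_value (presented_group R) k (p x) = presented_class R [Pos x]"
    and fk: "\<And>y. word_value (presented_group S) f (q y) = presented_class S [Pos y]"
  shows "presented_group R \<cong> presented_group S"
proof -
  let ?G = "presented_group R" and ?H = "presented_group S"
  interpret G: group ?G by (rule group_presented_group)
  interpret H: group ?H by (rule group_presented_group)
  have f_closed: "range f \<subseteq> carrier ?H" and k_closed: "range k \<subseteq> carrier ?G"
    by (auto simp: f_def k_def)
  obtain \<phi> where \<phi>: "\<phi> \<in> hom ?G ?H" "\<And>w. \<phi> (presented_class R w) = word_value ?H f w"
    using H.presented_group_hom[OF f_closed f] by metis
  obtain \<psi> where \<psi>: "\<psi> \<in> hom ?H ?G" "\<And>w. \<psi> (presented_class S w) = word_value ?G k w"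
    using G.presented_group_hom[OF k_closed k] by metis
  have "\<psi> (\<phi> (presented_class R w)) = presented_class R w" for w
    using hom_word_value[OF group_presented_group group_presented_group \<psi>(1) f_closed, of w]
    by (simp add: \<phi>(2) \<psi>(2) kf word_value_presented_class f_def)
  moreover have "\<phi> (\<psi> (presented_class S w)) = presented_class S w" for w
    using hom_word_value[OF group_presented_group group_presented_group \<phi>(1) k_closed, of w]
    by (simp add: \<phi>(2) \<psi>(2) fk word_value_presented_class k_def)
  ultimately have "bij_betw \<phi> (carrier ?G) (carrier ?H)"
    using \<phi>(1) \<psi>(1)
    by (intro bij_betwI[where g = \<psi>]) (auto simp: hom_def carrier_presented_group)
  with \<phi>(1) show ?thesis
    by (auto simp: is_iso_def iso_def)
qed

section \<open>Rewriting with inverting and commuting pairs\<close>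

context group
begin

lemma inv_cancel:
  assumes "x \<in> carrier G" "y \<in> carrier G"
  shows "inv x \<otimes> (x \<otimes> y) = y" "x \<otimes> (inv x \<otimes> y) = y"
  using assms by (simp_all flip: m_assoc)

text \<open>Translates the two shapes of relator, up to the choice of letters, into a rule that
  moves \<open>x\<close> to the right. Products are nested as \<open>word_value\<close> produces
  them.\<close>

lemma conjugate_eq_iff:
  assumes "x \<in> carrier G" "y \<in> carrier G" "z \<in> carrier G"
  shows "x \<otimes> (y \<otimes> (inv x \<otimes> z)) = \<one> \<longleftrightarrow> x \<otimes> y = inv z \<otimes> x"
    and "z \<otimes> (x \<otimes> (y \<otimes> inv x)) = \<one> \<longleftrightarrow> x \<otimes> y = inv z \<otimes> x"
proof -
  have "x \<otimes> (y \<otimes> (inv x \<otimes> z)) = \<one> \<longleftrightarrow> (x \<otimes> y \<otimes> inv x) \<otimes> z = \<one>"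
    using assms by (simp add: m_assoc)
  also have "\<dots> \<longleftrightarrow> inv z = x \<otimes> y \<otimes> inv x"
    using assms by (metis inv_equality inv_closed l_inv m_closed)
  finally show "x \<otimes> (y \<otimes> (inv x \<otimes> z)) = \<one> \<longleftrightarrow> x \<otimes> y = inv z \<otimes> x"
    using assms by (simp add: inv_solve_right)
  have "z \<otimes> (x \<otimes> (y \<otimes> inv x)) = \<one> \<longleftrightarrow> z \<otimes> (x \<otimes> y \<otimes> inv x) = \<one>"
    using assms by (simp add: m_assoc)
  also have "\<dots> \<longleftrightarrow> inv z = x \<otimes> y \<otimes> inv x"
    using assms inv_solve_left[of "x \<otimes> y \<otimes> inv x" z \<one>] by auto
  finally show "z \<otimes> (x \<otimes> (y \<otimes> inv x)) = \<one> \<longleftrightarrow> x \<otimes> y = inv z \<otimes> x"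
    using assms by (simp add: inv_solve_right)
qed

lemma commutator_eq_one_iff:
  assumes "x \<in> carrier G" "y \<in> carrier G"
  shows "x \<otimes> (y \<otimes> (inv x \<otimes> inv y)) = \<one> \<longleftrightarrow> x \<otimes> y = y \<otimes> x"
  using assms conjugate_eq_iff(1)[of x y "inv y"] by simp

lemma swap_inv:
  assumes "x \<in> carrier G" "y \<in> carrier G" "z \<in> carrier G" "x \<otimes> y = z \<otimes> x"
  shows "x \<otimes> inv y = inv z \<otimes> x" and "inv x \<otimes> z = y \<otimes> inv x"
    and "inv x \<otimes> inv z = inv y \<otimes> inv x"
proof -
  have y: "y = inv x \<otimes> (z \<otimes> x)"
    using assms by (simp add: inv_solve_left)
  show "x \<otimes> inv y = inv z \<otimes> x" "inv x \<otimes> z = y \<otimes> inv x"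
      "inv x \<otimes> inv z = inv y \<otimes> inv x"
    using assms(1,3) by (simp_all add: y inv_mult_group m_assoc inv_cancel)
qed

text \<open>Lets a swap rule act inside a right-nested product, where a tail \<open>t\<close>
  follows.\<close>

lemma swap_left:
  assumes "x \<otimes> y = z \<otimes> x" "x \<in> carrier G" "y \<in> carrier G" "z \<in> carrier G" "t \<in> carrier G"
  shows "x \<otimes> (y \<otimes> t) = z \<otimes> (x \<otimes> t)"
  using assms by (simp flip: m_assoc)

lemma inverting_rules:
  assumes "x \<in> carrier G" "y \<in> carrier G" "x \<otimes> y = inv y \<otimes> x"
  shows "x \<otimes> y = inv y \<otimes> x" "x \<otimes> inv y = y \<otimes> x"
    "inv x \<otimes> y = inv y \<otimes> inv x" "inv x \<otimes> inv y = y \<otimes> inv x"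
  using assms swap_inv[of x y "inv y"] by simp_all

text \<open>Only for use with the premises discharged: the third premise is an instance of the first
  conclusion, so as conditional rewrite rules these loop.\<close>

lemmas inverting_simps = inverting_rules inverting_rules[THEN swap_left]

lemma commuting_rules:
  assumes "x \<in> carrier G" "y \<in> carrier G" "x \<otimes> y = y \<otimes> x"
  shows "x \<otimes> y = y \<otimes> x" "x \<otimes> inv y = inv y \<otimes> x"
    "inv x \<otimes> y = y \<otimes> inv x" "inv x \<otimes> inv y = inv y \<otimes> inv x"
  using assms swap_inv[of x y y] by simp_all

lemmas commuting_simps = commuting_rules commuting_rules[THEN swap_left]

text \<open>Here \<open>x\<close>, \<open>y\<close>, \<open>z\<close>, \<open>w\<close> are the
  generators of \<open>Gamma10\<close>, whose relations are the premises; the conclusions are the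
  relators of \<open>Gamma5\<close> at the images \<open>w\<close>, \<open>x \<otimes> z\<close>,
  \<open>x\<close>, \<open>x \<otimes> y\<close>. The rules move \<open>w\<close> to the left and
  \<open>z\<close> to the right of \<open>x\<close> and \<open>y\<close>.\<close>

lemma Gamma5_relations:
  assumes [simp]: "x \<in> carrier G" "y \<in> carrier G" "z \<in> carrier G" "w \<in> carrier G"
    and "z \<otimes> x = inv x \<otimes> z" "x \<otimes> w = inv w \<otimes> x"
    and "z \<otimes> y = inv y \<otimes> z" "y \<otimes> w = w \<otimes> y"
  shows "x \<otimes> w = inv w \<otimes> x"
    and "(x \<otimes> y) \<otimes> w = inv w \<otimes> (x \<otimes> y)"
    and "(x \<otimes> z) \<otimes> x = inv x \<otimes> (x \<otimes> z)"
    and "(x \<otimes> z) \<otimes> (x \<otimes> y) = inv (x \<otimes> y) \<otimes> (x \<otimes> z)"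
proof -
  note rules = inverting_simps[OF assms(3,1,5)] inverting_simps[OF assms(1,4,6)]
    inverting_simps[OF assms(3,2,7)] commuting_simps[OF assms(2,4,8)]
  show "x \<otimes> w = inv w \<otimes> x"
    and "(x \<otimes> y) \<otimes> w = inv w \<otimes> (x \<otimes> y)"
    and "(x \<otimes> z) \<otimes> x = inv x \<otimes> (x \<otimes> z)"
    and "(x \<otimes> z) \<otimes> (x \<otimes> y) = inv (x \<otimes> y) \<otimes> (x \<otimes> z)"
    by (simp_all add: rules m_assoc inv_mult_group inv_cancel)
qed

text \<open>The reverse direction, with images \<open>z\<close>, \<open>inv z \<otimes> w\<close>,
  \<open>inv z \<otimes> y\<close>, \<open>x\<close>. The last conclusion is a commutation because
  \<open>z\<close> and \<open>w\<close> both invert \<open>x\<close>.\<close>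

lemma Gamma10_relations:
  assumes [simp]: "x \<in> carrier G" "y \<in> carrier G" "z \<in> carrier G" "w \<in> carrier G"
    and "z \<otimes> x = inv x \<otimes> z" "w \<otimes> x = inv x \<otimes> w"
    and "y \<otimes> z = inv z \<otimes> y" "y \<otimes> w = inv w \<otimes> y"
  shows "(inv z \<otimes> y) \<otimes> z = inv z \<otimes> (inv z \<otimes> y)"
    and "z \<otimes> x = inv x \<otimes> z"
    and "(inv z \<otimes> y) \<otimes> (inv z \<otimes> w) = inv (inv z \<otimes> w) \<otimes> (inv z \<otimes> y)"
    and "(inv z \<otimes> w) \<otimes> x = x \<otimes> (inv z \<otimes> w)"
proof -
  note rules = inverting_simps[OF assms(3,1,5)] inverting_simps[OF assms(4,1,6)]
    inverting_simps[OF assms(2,3,7)] inverting_simps[OF assms(2,4,8)]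
  show "(inv z \<otimes> y) \<otimes> z = inv z \<otimes> (inv z \<otimes> y)"
    and "z \<otimes> x = inv x \<otimes> z"
    and "(inv z \<otimes> y) \<otimes> (inv z \<otimes> w) = inv (inv z \<otimes> w) \<otimes> (inv z \<otimes> y)"
    and "(inv z \<otimes> w) \<otimes> x = x \<otimes> (inv z \<otimes> w)"
    by (simp_all add: rules m_assoc inv_mult_group inv_cancel)
qed

end

section \<open>The two concrete presentations\<close>

theorem proposition9: "Gamma5 \<cong> Gamma10"
proof -
  define R :: "gen word set" where
    "R = {[Pos a, Pos c, Pos a, Neg c], [Pos a, Pos d, Pos a, Neg d],
          [Pos b, Pos c, Neg b, Pos c], [Pos b, Pos d, Neg b, Pos d]}"
  define S :: "gen word set" where
    "S = {[Pos a, Pos c, Pos a, Neg c], [Pos a, Pos d, Neg a, Pos d],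
          [Pos b, Pos c, Pos b, Neg c], [Pos b, Pos d, Neg b, Neg d]}"
  \<comment> \<open>Substituting \<open>p\<close> and \<open>q\<close> into each other gives back
    each generator by free cancellation alone, so the relators matter only for the existence of the
    homomorphisms.\<close>
  define p :: "gen \<Rightarrow> gen word" where
    "p = case_gen [Pos d] [Pos a, Pos c] [Pos a] [Pos a, Pos b]"
  define q :: "gen \<Rightarrow> gen word" where
    "q = case_gen [Pos c] [Neg c, Pos d] [Neg c, Pos b] [Pos a]"
  interpret G: group "presented_group R" by (rule group_presented_group)
  interpret H: group "presented_group S" by (rule group_presented_group)
  define \<gamma> where "\<gamma> = (\<lambda>x. presented_class R [Pos x])"
  define \<eta> where "\<eta> = (\<lambda>x. presented_class S [Pos x])"
  have [simp]: "\<gamma> x \<in> carrier (presented_group R)" "\<eta> x \<in> carrier (presented_group S)" for x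
    by (simp_all add: \<gamma>_def \<eta>_def)
  \<comment> \<open>Membership as a disjunction lets the statement about all relators split into one
    equation per relator.\<close>
  have R_mem: "r \<in> R \<longleftrightarrow> r = [Pos a, Pos c, Pos a, Neg c] \<or> r = [Pos a, Pos d, Pos a, Neg d]
      \<or> r = [Pos b, Pos c, Neg b, Pos c] \<or> r = [Pos b, Pos d, Neg b, Pos d]" for r
    by (simp add: R_def)
  have "\<forall>r. r \<in> R \<longrightarrow> word_value (presented_group R) \<gamma> r = \<one>\<^bsub>presented_group R\<^esub>"
    by (simp add: \<gamma>_def word_value_presented_class presented_class_relator)
  note R_values = this[unfolded R_mem imp_disjL all_conj_distrib, simplified]
  have S_mem: "r \<in> S \<longleftrightarrow> r = [Pos a, Pos c, Pos a, Neg c] \<or> r = [Pos a, Pos d, Neg a, Pos d]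
      \<or> r = [Pos b, Pos c, Pos b, Neg c] \<or> r = [Pos b, Pos d, Neg b, Neg d]" for r
    by (simp add: S_def)
  have "\<forall>r. r \<in> S \<longrightarrow> word_value (presented_group S) \<eta> r = \<one>\<^bsub>presented_group S\<^esub>"
    by (simp add: \<eta>_def word_value_presented_class presented_class_relator)
  note S_values = this[unfolded S_mem imp_disjL all_conj_distrib, simplified]
  \<comment> \<open>The images become products of the generators \<open>\<eta>\<close>, to which the
    relations apply; likewise for \<open>q\<close> and \<open>\<gamma>\<close>.\<close>
  have p: "presented_class S (p x) = word_value (presented_group S) \<eta> (p x)" for x
    by (simp add: \<eta>_def word_value_presented_class)
  have q: "presented_class R (q x) = word_value (presented_group R) \<gamma> (q x)" for x
    by (simp add: \<gamma>_def word_value_presented_class)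
  have R_relations: "\<gamma> c \<otimes>\<^bsub>presented_group R\<^esub> \<gamma> a = inv\<^bsub>presented_group R\<^esub> \<gamma> a \<otimes>\<^bsub>presented_group R\<^esub> \<gamma> c"
      "\<gamma> d \<otimes>\<^bsub>presented_group R\<^esub> \<gamma> a = inv\<^bsub>presented_group R\<^esub> \<gamma> a \<otimes>\<^bsub>presented_group R\<^esub> \<gamma> d"
      "\<gamma> b \<otimes>\<^bsub>presented_group R\<^esub> \<gamma> c = inv\<^bsub>presented_group R\<^esub> \<gamma> c \<otimes>\<^bsub>presented_group R\<^esub> \<gamma> b"
      "\<gamma> b \<otimes>\<^bsub>presented_group R\<^esub> \<gamma> d = inv\<^bsub>presented_group R\<^esub> \<gamma> d \<otimes>\<^bsub>presented_group R\<^esub> \<gamma> b"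
    using R_values by (simp_all add: G.conjugate_eq_iff)
  have S_relations: "\<eta> c \<otimes>\<^bsub>presented_group S\<^esub> \<eta> a = inv\<^bsub>presented_group S\<^esub> \<eta> a \<otimes>\<^bsub>presented_group S\<^esub> \<eta> c"
      "\<eta> a \<otimes>\<^bsub>presented_group S\<^esub> \<eta> d = inv\<^bsub>presented_group S\<^esub> \<eta> d \<otimes>\<^bsub>presented_group S\<^esub> \<eta> a"
      "\<eta> c \<otimes>\<^bsub>presented_group S\<^esub> \<eta> b = inv\<^bsub>presented_group S\<^esub> \<eta> b \<otimes>\<^bsub>presented_group S\<^esub> \<eta> c"
      "\<eta> b \<otimes>\<^bsub>presented_group S\<^esub> \<eta> d = \<eta> d \<otimes>\<^bsub>presented_group S\<^esub> \<eta> b"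
    \<comment> \<open>Commutators first: they also match \<open>conjugate_eq_iff\<close>, with another outcome.\<close>
    using S_values by (simp_all add: H.commutator_eq_one_iff) (simp_all add: H.conjugate_eq_iff)
  have "presented_group R \<cong> presented_group S"
  proof (rule presented_group_isoI[where p = p and q = q])
    fix r assume "r \<in> R"
    then show "word_value (presented_group S) (\<lambda>x. presented_class S (p x)) r = \<one>\<^bsub>presented_group S\<^esub>"
      using H.Gamma5_relations[OF _ _ _ _ S_relations]
      unfolding p R_mem
      by (elim disjE) (simp_all add: p_def H.conjugate_eq_iff)
  next
    fix r assume "r \<in> S"
    then show "word_value (presented_group R) (\<lambda>x. presented_class R (q x)) r = \<one>\<^bsub>presented_group R\<^esub>"
      using G.Gamma10_relations[OF _ _ _ _ R_relations]
      unfolding q S_mem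
      by (elim disjE, simp_all add: q_def G.commutator_eq_one_iff) (simp_all add: G.conjugate_eq_iff)
  next
    fix x
    show "word_value (presented_group R) (\<lambda>y. presented_class R (q y)) (p x) = presented_class R [Pos x]"
      unfolding q \<gamma>_def[THEN fun_cong, symmetric]
      by (cases x) (simp_all add: p_def q_def G.inv_cancel)
  next
    fix x
    show "word_value (presented_group S) (\<lambda>y. presented_class S (p y)) (q x) = presented_class S [Pos x]"
      unfolding p \<eta>_def[THEN fun_cong, symmetric]
      by (cases x) (simp_all add: p_def q_def H.inv_cancel)
  qed
  then show ?thesis
    by (simp add: Gamma5_def Gamma10_def R_def S_def)
qed

end
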